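(* Let $n\ge5$ and let $g=\gcd(n,3)$. Define $$z_n=\begin{cases}\dfrac{\Bigl(\prod_{i=5}^{n}\Delta_{12i}\Bigr)^{3}\bigl(\Delta_{134}\Delta_{234}\bigr)^{n-3}}{\bigl(\Delta_{123}\Delta_{124}\bigr)^{2n-9}}, & \text{if } g=1,\\[14pt] \dfrac{\Bigl(\prod_{i=5}^{n}\Delta_{12i}\Bigr)\bigl(\Delta_{134}\Delta_{234}\bigr)^{\frac n3-1}}{\bigl(\Delta_{123}\Delta_{124}\bigr)^{\frac{2n}{3}-3}}, & \text{if } g=3.\end{cases}$$ Then $z_n$ is a relative first-order joint projective invariant of $n$ points, and its weight is $$\operatorname{wt}(z_n)=-\frac1g.$$
   Context: Let $J_1^{(n)}=\mathbb{R}(x_1,y_1,p_1,q_1,\dots,x_n,y_n,p_n,q_n)$ be the field of rational functions in $4n$ independent variables; $(x_i,y_i)$ is thought of as a point of the plane and $(p_i,q_i)$ as the gradient at that point of a function $u$. Action of $PGL(3,\mathbb{R})$: for the class of an invertible matrix with rows $(a_1,a_2,a_3),(b_1,b_2,b_3),(c_1,c_2,c_3)$ and determinant $D$, the projective transformation is $T(x,y)=\left(\frac{a_1x+a_2y+a_3}{c_1x+c_2y+c_3},\frac{b_1x+b_2y+b_3}{c_1x+c_2y+c_3}\right)$. It acts diagonally: $(x_i,y_i)\mapsto T(x_i,y_i)$ for every $i$, and on the gradients by the first prolongation of $u\mapsto u\circ T^{-1}$, i.e. the row vector $(p_i,q_i)$ is sent to $(p_i,q_i)\,\bigl(DT(x_i,y_i)\bigr)^{-1}$,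 where $DT$ is the $2\times2$ Jacobian matrix of $T$. The total Jacobian is $$J(T)=\prod_{i=1}^n\frac{D}{(c_1x_i+c_2y_i+c_3)^3}.$$ An element $F\in J_1^{(n)}$ is a relative first-order joint projective invariant of weight $\omega$ (written $\operatorname{wt}(F)=\omega$) if, for every $T\in PGL(3,\mathbb{R})$, replacing all variables by their images under $T$ turns $F$ into $J(T)^{\omega}F$. For $\omega\in\frac13\mathbb{Z}$ the power $J(T)^\omega$ is taken with the real cube root. Set $\ell_i=(p_i,q_i,-p_ix_i-q_iy_i)$ and $\Delta_{ijk}=\det(\ell_i,\ell_j,\ell_k)$. *)

theory Defs
  imports "HOL-Analysis.Analysis" "HOL-Library.Poly_Mapping"
    "HOL-Computational_Algebra.Fraction_Field"
begin

section \<open>Rational functions in the joint jet variables\<close>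

text \<open>Polynomials over the reals in variables indexed by \<^typ>\<open>nat\<close>, and their quotient field.
  The coordinates of the \<open>i\<close>-th point and gradient are the variables with indices
  \<open>4 * i, ..., 4 * i + 3\<close>; points are numbered from 1.\<close>

type_synonym jpoly = "(nat \<Rightarrow>\<^sub>0 nat) \<Rightarrow>\<^sub>0 real"
type_synonym jrat = "jpoly fract"

definition const :: "real \<Rightarrow> jrat" where
  "const c = Fract (Poly_Mapping.single 0 c) 1"

definition var :: "nat \<Rightarrow> jrat" where
  "var v = Fract (Poly_Mapping.single (Poly_Mapping.single v 1) 1) 1"

definition xvar :: "nat \<Rightarrow> jrat" where "xvar i = var (4 * i)"
definition yvar :: "nat \<Rightarrow> jrat" where "yvar i = var (4 * i + 1)"
definition pvar :: "nat \<Rightarrow> jrat" where "pvar i = var (4 * i + 2)"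
definition qvar :: "nat \<Rightarrow> jrat" where "qvar i = var (4 * i + 3)"

definition poly_vars :: "jpoly \<Rightarrow> nat set" where
  "poly_vars f = (\<Union>m\<in>Poly_Mapping.keys f. Poly_Mapping.keys m)"

definition joint_field :: "nat \<Rightarrow> jrat set" where
  "joint_field n = {Fract a b | a b. b \<noteq> 0 \<and>
     poly_vars a \<subseteq> {v. v div 4 \<in> {1..n}} \<and> poly_vars b \<subseteq> {v. v div 4 \<in> {1..n}}}"

definition poly_subst :: "(nat \<Rightarrow> jrat) \<Rightarrow> jpoly \<Rightarrow> jrat" where
  "poly_subst s f = (\<Sum>m\<in>Poly_Mapping.keys f.
     const (Poly_Mapping.lookup f m) *
       (\<Prod>v\<in>Poly_Mapping.keys m. s v ^ Poly_Mapping.lookup m v))"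

text \<open>Substitution in a quotient of polynomials. The value does not depend on the representation
  as long as the substituted denominator is nonzero; such a representation always
  exists when \<open>s\<close> is algebraically independent, in particular for the images of the variables
  under an invertible transformation.\<close>

definition rat_subst :: "(nat \<Rightarrow> jrat) \<Rightarrow> jrat \<Rightarrow> jrat" where
  "rat_subst s F = (THE G. \<exists>a b. F = Fract a b \<and> poly_subst s b \<noteq> 0 \<and>
     G = poly_subst s a / poly_subst s b)"


section \<open>Projective transformations\<close>

text \<open>These are stated over an arbitrary field, so that they apply both to real points and to
  the generic point \<open>(x, y)\<close> with coordinates in the field of rational functions.\<close>

definition homog :: "('a::field)^3^3 \<Rightarrow> 'a^2 \<Rightarrow> 'a^3" where
  "homog A v = A *v vector [v$1, v$2, 1]"

definition proj_map :: "('a::field)^3^3 \<Rightarrow> 'a^2 \<Rightarrow> 'a^2" where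
  "proj_map A v = vector [homog A v $ 1 / homog A v $ 3, homog A v $ 2 / homog A v $ 3]"

text \<open>The Jacobian matrix of \<^const>\<open>proj_map\<close>, written out by the quotient rule; see
  \<open>proj_map_has_derivative\<close> below.\<close>

definition proj_deriv :: "('a::field)^3^3 \<Rightarrow> 'a^2 \<Rightarrow> 'a^2^2" where
  "proj_deriv A v = (let h = homog A v in
     vector
      [vector [(A$1$1 * h$3 - h$1 * A$3$1) / (h$3)^2, (A$1$2 * h$3 - h$1 * A$3$2) / (h$3)^2],
       vector [(A$2$1 * h$3 - h$2 * A$3$1) / (h$3)^2, (A$2$2 * h$3 - h$2 * A$3$2) / (h$3)^2]])"

lemma homog_simps:
  "homog A v $ k = A$k$1 * v$1 + A$k$2 * v$2 + A$k$3"
  by (simp add: homog_def matrix_vector_mult_def sum_3)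

lemma proj_map_has_derivative:
  fixes A :: "real^3^3" and v :: "real^2"
  assumes "homog A v $ 3 \<noteq> 0"
  shows "(proj_map A has_derivative (\<lambda>h. proj_deriv A v *v h)) (at v)"
proof -
  have lin: "((\<lambda>v. homog A v $ k) has_derivative (\<lambda>h. A$k$1 * h$1 + A$k$2 * h$2)) (at v)" for k
  proof -
    have "((\<lambda>v::real^2. v$i) has_derivative (\<lambda>h. h$i)) (at v)" for i
      by (rule bounded_linear_imp_has_derivative) (rule bounded_linear_vec_nth)
    then have "((\<lambda>v. A$k$1 * v$1 + A$k$2 * v$2 + A$k$3) has_derivative
        (\<lambda>h. A$k$1 * h$1 + A$k$2 * h$2 + 0)) (at v)"
      by (intro has_derivative_add has_derivative_mult_right has_derivative_const)
    then show ?thesis by (simp add: homog_simps)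
  qed
  have comp: "((\<lambda>v. homog A v $ k / homog A v $ 3) has_derivative
      (\<lambda>h. (A$k$1 * homog A v $ 3 - homog A v $ k * A$3$1) / (homog A v $ 3)^2 * h$1
         + (A$k$2 * homog A v $ 3 - homog A v $ k * A$3$2) / (homog A v $ 3)^2 * h$2)) (at v)" for k
  proof (rule has_derivative_eq_rhs[OF has_derivative_divide'[OF lin lin assms]], rule ext)
    fix h :: "real^2"
    show "((A$k$1 * h$1 + A$k$2 * h$2) * homog A v $ 3
          - homog A v $ k * (A$3$1 * h$1 + A$3$2 * h$2)) / (homog A v $ 3 * homog A v $ 3)
        = (A$k$1 * homog A v $ 3 - homog A v $ k * A$3$1) / (homog A v $ 3)^2 * h$1
         + (A$k$2 * homog A v $ 3 - homog A v $ k * A$3$2) / (homog A v $ 3)^2 * h$2"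
      by (simp add: power2_eq_square algebra_simps flip: add_divide_distrib diff_divide_distrib)
  qed
  show ?thesis
    unfolding has_derivative_componentwise_within[of "proj_map A"]
  proof
    fix b :: "real^2" assume "b \<in> Basis"
    then obtain i where b: "b = axis i 1" by (auto simp: Basis_vec_def)
    have "i = 1 \<or> i = 2" by (rule exhaust_2)
    then show "((\<lambda>x. proj_map A x \<bullet> b) has_derivative (\<lambda>h. (proj_deriv A v *v h) \<bullet> b)) (at v)"
      using comp[of 1] comp[of 2]
      by (auto simp: b inner_axis proj_map_def proj_deriv_def Let_def
          matrix_vector_mult_def sum_2)
  qed
qed

definition const_mat :: "real^3^3 \<Rightarrow> jrat^3^3" where
  "const_mat A = (\<chi> i j. const (A$i$j))"

definition pt :: "nat \<Rightarrow> jrat^2" where "pt i = vector [xvar i, yvar i]"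

definition gradvec :: "nat \<Rightarrow> jrat^2" where "gradvec i = vector [pvar i, qvar i]"

definition pt_image :: "real^3^3 \<Rightarrow> nat \<Rightarrow> jrat^2" where
  "pt_image A i = proj_map (const_mat A) (pt i)"

definition grad_image :: "real^3^3 \<Rightarrow> nat \<Rightarrow> jrat^2" where
  "grad_image A i = gradvec i v* matrix_inv (proj_deriv (const_mat A) (pt i))"

definition var_image :: "real^3^3 \<Rightarrow> nat \<Rightarrow> jrat" where
  "var_image A v = (let i = v div 4 in
     if v mod 4 = 0 then pt_image A i $ 1
     else if v mod 4 = 1 then pt_image A i $ 2
     else if v mod 4 = 2 then grad_image A i $ 1
     else grad_image A i $ 2)"


section \<open>Relative invariants\<close>

definition total_jac :: "nat \<Rightarrow> real^3^3 \<Rightarrow> jrat" where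
  "total_jac n A = (\<Prod>i=1..n. const (det A) / (homog (const_mat A) (pt i) $ 3) ^ 3)"

text \<open>The cube root of \<^const>\<open>total_jac\<close>. It is the only one in the field of rational functions,
  since that field is formally real. Note that \<^term>\<open>root 3\<close> is the real cube root, of either
  sign.\<close>

definition total_jac_cbrt :: "nat \<Rightarrow> real^3^3 \<Rightarrow> jrat" where
  "total_jac_cbrt n A = (\<Prod>i=1..n. const (root 3 (det A)) / homog (const_mat A) (pt i) $ 3)"

lemma const_mult: "const (a * b) = const a * const b"
  by (simp add: const_def mult_single)

lemma total_jac_cbrt_cubed: "total_jac_cbrt n A ^ 3 = total_jac n A"
proof -
  have "const (root 3 d) ^ 3 = const d" for d
  proof -
    have "const (root 3 d) ^ 3 = const (root 3 d ^ 3)"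
      by (simp add: power3_eq_cube const_mult)
    also have "root 3 d ^ 3 = d"
      by (rule odd_real_root_pow) simp
    finally show ?thesis .
  qed
  then show ?thesis
    by (simp add: total_jac_cbrt_def total_jac_def power_divide prod_power_distrib)
qed

text \<open>The power with exponent in one third of the integers; only used for such exponents.\<close>

definition total_jac_pow :: "nat \<Rightarrow> real^3^3 \<Rightarrow> rat \<Rightarrow> jrat" where
  "total_jac_pow n A w = total_jac_cbrt n A powi \<lfloor>3 * w\<rfloor>"

lemma total_jac_pow_of_int: "total_jac_pow n A (of_int k) = total_jac n A powi k"
proof -
  have "\<lfloor>3 * (of_int k :: rat)\<rfloor> = 3 * k"
    by (metis floor_of_int of_int_mult of_int_numeral)
  then have "total_jac_pow n A (of_int k) = (total_jac_cbrt n A powi 3) powi k"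
    by (simp add: total_jac_pow_def power_int_mult del: power_int_numeral)
  then show ?thesis
    by (simp add: total_jac_cbrt_cubed)
qed

text \<open>A class in the projective group is given by any of its representatives \<open>A\<close>: both
  \<^term>\<open>var_image A\<close> and \<^term>\<open>total_jac_pow n A w\<close> are unchanged when \<open>A\<close> is rescaled.\<close>

definition rel_invariant :: "nat \<Rightarrow> rat \<Rightarrow> jrat \<Rightarrow> bool" where
  "rel_invariant n w F \<longleftrightarrow> F \<in> joint_field n \<and> 3 * w \<in> \<int> \<and>
     (\<forall>A :: real^3^3. invertible A \<longrightarrow> rat_subst (var_image A) F = total_jac_pow n A w * F)"

definition wt :: "nat \<Rightarrow> jrat \<Rightarrow> rat" where
  "wt n F = (THE w. rel_invariant n w F)"


section \<open>The functions z\<close>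

definition ell :: "nat \<Rightarrow> jrat^3" where
  "ell i = vector [pvar i, qvar i, - pvar i * xvar i - qvar i * yvar i]"

definition Delta :: "nat \<Rightarrow> nat \<Rightarrow> nat \<Rightarrow> jrat" where
  "Delta i j k = det (vector [ell i, ell j, ell k] :: jrat^3^3)"

text \<open>All exponents are natural numbers for \<open>n \<ge> 5\<close>, and the divisions by 3 are exact.\<close>

definition zfun :: "nat \<Rightarrow> jrat" where
  "zfun n = (if gcd n 3 = 1
     then (\<Prod>i=5..n. Delta 1 2 i) ^ 3 * (Delta 1 3 4 * Delta 2 3 4) ^ (n - 3)
            / (Delta 1 2 3 * Delta 1 2 4) ^ (2 * n - 9)
     else (\<Prod>i=5..n. Delta 1 2 i) * (Delta 1 3 4 * Delta 2 3 4) ^ (n div 3 - 1)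
            / (Delta 1 2 3 * Delta 1 2 4) ^ (2 * n div 3 - 3))"

end

theory Submission
  imports Defs
begin

text \<open>The covector \<open>\<ell>\<^sub>i\<close> gives the line \<open>p\<^sub>i (X - x\<^sub>i) + q\<^sub>i (Y - y\<^sub>i) = 0\<close>, the tangent at the \<open>i\<close>-th point
  to the level curve of \<open>u\<close>. A projective transformation with matrix \<open>A\<close> carries lines to lines,
  hence multiplies these covectors by \<open>A\<^sup>-\<^sup>1\<close> on the right up to a scalar, and the scalar turns out
  to be the denominator \<open>h\<^sub>i = c\<^sub>1 x\<^sub>i + c\<^sub>2 y\<^sub>i + c\<^sub>3\<close> (\<open>level_line_covariant\<close>). Taking determinants
  of three of them,
  \<open>\<Delta>\<^sub>i\<^sub>j\<^sub>k\<close> is multiplied by \<open>h\<^sub>i h\<^sub>j h\<^sub>k / D\<close> (\<open>Delta_transform\<close>).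

  The rest is counting exponents. A product of powers of the \<open>\<Delta>\<^sub>i\<^sub>j\<^sub>k\<close> is multiplied by a power of
  \<open>\<Prod>\<^sub>i h\<^sub>i\<close> times a power of \<open>D\<close> exactly when each of the \<open>n\<close> indices has the same total degree \<open>e\<close>.
  Counted with their exponents, there are then \<open>n e / 3\<close> brackets, so the multiplier is
  \<open>(\<Prod>\<^sub>i h\<^sub>i)\<^sup>e / D\<^bsup>n e / 3\<^esup>\<close>, which is \<open>J(T)\<close> to the power \<open>- e / 3\<close>. Both
  formulas for \<open>z\<^sub>n\<close> are balanced in this sense, with \<open>e = 3\<close> and \<open>e = 1\<close> respectively
  (\<open>bracket_quotient_rel_invariant\<close>).

  The weight is well defined because the brackets do not vanish identically and because a
  diagonal matrix gives \<open>J(T)\<close> a constant value greater than \<open>1\<close> (\<open>rel_invariant_weight_unique\<close>).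

  Substitution into a rational function is handled by the relation \<open>substitutes\<close>, which respects
  the field operations as long as no divisor is sent to zero. Evaluating at suitable points with the
  same relation shows that rational functions are nonzero.\<close>

section \<open>Substitution is a homomorphism\<close>

lemma const_0 [simp]: "const 0 = 0"
  by (simp add: const_def fract_collapse)

lemma const_1 [simp]: "const 1 = 1"
  by (simp add: const_def fract_collapse)

lemma const_add: "const (a + b) = const a + const b"
  by (simp add: const_def single_add)

lemma const_minus: "const (- a) = - const a"
  by (simp add: const_def single_uminus)

lemma const_diff: "const (a - b) = const a - const b"
  using const_add[of a "- b"] by (simp add: const_minus)

lemma const_eq_iff [simp]: "const a = const b \<longleftrightarrow> a = b"
proof
  assume "const a = const b"
  then have "(Poly_Mapping.single 0 a :: jpoly) = Poly_Mapping.single 0 b"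
    unfolding const_def by (subst (asm) eq_fract(1)) simp_all
  then show "a = b"
    by (metis lookup_single_eq)
qed simp

lemma const_eq_0_iff [simp]: "const a = 0 \<longleftrightarrow> a = 0"
  using const_eq_iff[of a 0] unfolding const_0 .

lemma const_power: "const (a ^ k) = const a ^ k"
  by (induction k) (simp_all add: const_mult)

lemma const_inverse: "const (inverse a) = inverse (const a)"
proof (cases "a = 0")
  case False
  then have "const a * const (inverse a) = 1"
    by (simp flip: const_mult)
  then show ?thesis
    by (rule inverse_unique[symmetric])
qed simp

lemma const_power_int: "const (a powi k) = const a powi k"
  by (simp add: power_int_def const_power const_inverse)

definition monom_subst :: "(nat \<Rightarrow> jrat) \<Rightarrow> (nat \<Rightarrow>\<^sub>0 nat) \<Rightarrow> jrat" where
  "monom_subst s m = (\<Prod>v\<in>Poly_Mapping.keys m. s v ^ Poly_Mapping.lookup m v)"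

lemma monom_subst_superset:
  assumes "finite S" "Poly_Mapping.keys m \<subseteq> S"
  shows "monom_subst s m = (\<Prod>v\<in>S. s v ^ Poly_Mapping.lookup m v)"
  unfolding monom_subst_def
  by (rule prod.mono_neutral_left) (use assms in \<open>auto simp: in_keys_iff\<close>)

lemma monom_subst_0 [simp]: "monom_subst s 0 = 1"
  by (simp add: monom_subst_def)

lemma monom_subst_add: "monom_subst s (m + m') = monom_subst s m * monom_subst s m'"
proof -
  let ?S = "Poly_Mapping.keys m \<union> Poly_Mapping.keys m'"
  have "Poly_Mapping.keys (m + m') \<subseteq> ?S"
    by (rule keys_add)
  then show ?thesis
    by (simp add: monom_subst_superset[of ?S] lookup_add power_add prod.distrib)
qed

lemma poly_subst_alt:
  "poly_subst s f = (\<Sum>m\<in>Poly_Mapping.keys f. const (Poly_Mapping.lookup f m) * monom_subst s m)"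
  by (simp add: poly_subst_def monom_subst_def)

lemma poly_subst_single: "poly_subst s (Poly_Mapping.single m c) = const c * monom_subst s m"
  by (simp add: poly_subst_alt)

lemma poly_subst_0 [simp]: "poly_subst s 0 = 0"
  by (simp add: poly_subst_alt)

lemma poly_subst_1 [simp]: "poly_subst s 1 = 1"
  using poly_subst_single[of s 0 1] by simp

lemma poly_subst_add: "poly_subst s (f + g) = poly_subst s f + poly_subst s g"
  unfolding poly_subst_alt
  by (rule setsum_keys_plus_distrib) (simp_all add: const_add distrib_right)

text \<open>Peeling off one term at a time makes multiplicativity of the substitution a statement about
  monomials.\<close>

lemma jpoly_induct [case_names zero add_single]:
  fixes f :: jpoly
  assumes "P 0" and "\<And>f m c. P f \<Longrightarrow> P (Poly_Mapping.single m c + f)"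
  shows "P f"
proof (induction f rule: update_induct)
  case const
  show ?case by fact
next
  case (update f a b)
  have "Poly_Mapping.update a b f = Poly_Mapping.single a b + f"
    using update(1)
    by (intro poly_mapping_eqI) (auto simp: lookup_update lookup_add lookup_single in_keys_iff)
  then show ?case
    using assms(2) update by simp
qed

lemma poly_subst_mult: "poly_subst s (f * g) = poly_subst s f * poly_subst s g"
proof (induction f rule: jpoly_induct)
  case zero
  show ?case by simp
next
  case (add_single f m c)
  have "poly_subst s (Poly_Mapping.single m c * g) = const c * monom_subst s m * poly_subst s g"
  proof (induction g rule: jpoly_induct)
    case zero
    show ?case by simp
  next
    case (add_single g m' c')
    then show ?case
      by (simp add: distrib_left poly_subst_add mult_single poly_subst_single const_mult
          monom_subst_add mult_ac)
  qed
  with add_single show ?case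
    by (simp add: distrib_right poly_subst_add poly_subst_single)
qed

lemma poly_subst_minus: "poly_subst s (- f) = - poly_subst s f"
  using poly_subst_add[of s f "- f"] by (simp add: eq_neg_iff_add_eq_0 add.commute)

text \<open>Substitution is a partial operation on rational functions, defined where some representation has
  a denominator that survives. A relation records both the value and its existence, so that the
  value at a quotient of brackets can be built up from the values at the variables.\<close>

definition substitutes :: "(nat \<Rightarrow> jrat) \<Rightarrow> jrat \<Rightarrow> jrat \<Rightarrow> bool" where
  "substitutes s F G \<longleftrightarrow> (\<exists>a b. F = Fract a b \<and> poly_subst s b \<noteq> 0 \<and>
     G = poly_subst s a / poly_subst s b)"

lemma substitutesI:
  "F = Fract a b \<Longrightarrow> poly_subst s b \<noteq> 0 \<Longrightarrow> G = poly_subst s a / poly_subst s b \<Longrightarrow>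
    substitutes s F G"
  unfolding substitutes_def by blast

text \<open>If \<open>a d = c b\<close>, then the homomorphism \<^term>\<open>poly_subst s\<close> preserves this identity, so two
  representations with surviving denominators give the same quotient.\<close>

lemma substitutes_unique:
  assumes "substitutes s F G" "substitutes s F G'"
  shows "G = G'"
proof -
  obtain a b where 1: "F = Fract a b" "poly_subst s b \<noteq> 0" "G = poly_subst s a / poly_subst s b"
    using assms(1) unfolding substitutes_def by blast
  obtain c d where 2: "F = Fract c d" "poly_subst s d \<noteq> 0" "G' = poly_subst s c / poly_subst s d"
    using assms(2) unfolding substitutes_def by blast
  have "b \<noteq> 0" "d \<noteq> 0"
    using 1 2 by auto
  with 1(1) 2(1) have "a * d = c * b"
    by (simp add: eq_fract)
  then have "poly_subst s a * poly_subst s d = poly_subst s c * poly_subst s b"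
    by (simp flip: poly_subst_mult)
  with 1 2 show ?thesis
    by (simp add: frac_eq_eq)
qed

lemma rat_subst_eqI:
  assumes "substitutes s F G"
  shows "rat_subst s F = G"
proof -
  have "rat_subst s F = (THE G. substitutes s F G)"
    by (simp add: rat_subst_def substitutes_def)
  also have "\<dots> = G"
    by (rule the_equality) (use assms in \<open>auto intro: substitutes_unique\<close>)
  finally show ?thesis .
qed

lemma substitutes_const: "substitutes s (const c) (const c)"
  by (rule substitutesI[OF const_def]) (simp_all add: poly_subst_single)

lemma substitutes_var: "substitutes s (var v) (s v)"
  by (rule substitutesI[OF var_def]) (simp_all add: poly_subst_single monom_subst_def)

lemma substitutes_0: "substitutes s 0 0"
  using substitutes_const[of s 0] by simp

lemma substitutes_1: "substitutes s 1 1"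
  using substitutes_const[of s 1] by simp

lemma substitutes_add:
  assumes "substitutes s F G" "substitutes s F' G'"
  shows "substitutes s (F + F') (G + G')"
proof -
  obtain a b where 1: "F = Fract a b" "poly_subst s b \<noteq> 0" "G = poly_subst s a / poly_subst s b"
    using assms(1) unfolding substitutes_def by blast
  obtain c d where 2: "F' = Fract c d" "poly_subst s d \<noteq> 0" "G' = poly_subst s c / poly_subst s d"
    using assms(2) unfolding substitutes_def by blast
  have "b \<noteq> 0" "d \<noteq> 0"
    using 1 2 by auto
  with 1 2 show ?thesis
    by (intro substitutesI[of _ "a * d + c * b" "b * d"])
      (simp_all add: poly_subst_add poly_subst_mult add_frac_eq)
qed

lemma substitutes_mult:
  assumes "substitutes s F G" "substitutes s F' G'"
  shows "substitutes s (F * F') (G * G')"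
proof -
  obtain a b where 1: "F = Fract a b" "poly_subst s b \<noteq> 0" "G = poly_subst s a / poly_subst s b"
    using assms(1) unfolding substitutes_def by blast
  obtain c d where 2: "F' = Fract c d" "poly_subst s d \<noteq> 0" "G' = poly_subst s c / poly_subst s d"
    using assms(2) unfolding substitutes_def by blast
  show ?thesis
    by (rule substitutesI[of _ "a * c" "b * d"]) (use 1 2 in \<open>simp_all add: poly_subst_mult\<close>)
qed

lemma substitutes_minus: "substitutes s F G \<Longrightarrow> substitutes s (- F) (- G)"
  using substitutes_mult[OF substitutes_const[of s "- 1"], of F G] by (simp add: const_minus)

lemma substitutes_inverse:
  assumes "substitutes s F G" "G \<noteq> 0"
  shows "substitutes s (inverse F) (inverse G)"
proof -
  obtain a b where 1: "F = Fract a b" "poly_subst s b \<noteq> 0" "G = poly_subst s a / poly_subst s b"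
    using assms(1) unfolding substitutes_def by blast
  show ?thesis
    by (rule substitutesI[of _ b a]) (use 1 assms(2) in simp_all)
qed

lemma substitutes_diff:
  "substitutes s F G \<Longrightarrow> substitutes s F' G' \<Longrightarrow> substitutes s (F - F') (G - G')"
  using substitutes_add[of s F G "- F'" "- G'"] substitutes_minus[of s F' G'] by simp

lemma substitutes_divide:
  "substitutes s F G \<Longrightarrow> substitutes s F' G' \<Longrightarrow> G' \<noteq> 0 \<Longrightarrow> substitutes s (F / F') (G / G')"
  using substitutes_mult[of s F G "inverse F'" "inverse G'"] substitutes_inverse[of s F' G']
  by (simp add: divide_inverse)

lemma substitutes_power: "substitutes s F G \<Longrightarrow> substitutes s (F ^ k) (G ^ k)"
  by (induction k) (simp_all add: substitutes_1 substitutes_mult)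

lemma substitutes_prod:
  "(\<And>i. i \<in> I \<Longrightarrow> substitutes s (F i) (G i)) \<Longrightarrow> substitutes s (prod F I) (prod G I)"
  by (induction I rule: infinite_finite_induct) (auto simp: substitutes_1 intro: substitutes_mult)

lemmas substitutes_intros = substitutes_add substitutes_minus substitutes_diff substitutes_mult

text \<open>The way to see that a rational function is not zero: find a substitution with nonzero value.\<close>

lemma substitutes_nonzero: "substitutes s F G \<Longrightarrow> G \<noteq> 0 \<Longrightarrow> F \<noteq> 0"
  using substitutes_0 substitutes_unique by blast


section \<open>Closure properties of the joint field\<close>

lemma poly_vars_add: "poly_vars (f + g) \<subseteq> poly_vars f \<union> poly_vars g"
  using keys_add[of f g] by (auto simp: poly_vars_def)

lemma poly_vars_minus [simp]: "poly_vars (- f) = poly_vars f"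
  by (simp add: poly_vars_def)

lemma poly_vars_mult: "poly_vars (f * g) \<subseteq> poly_vars f \<union> poly_vars g"
proof
  fix v assume "v \<in> poly_vars (f * g)"
  then obtain m where "m \<in> Poly_Mapping.keys (f * g)" "v \<in> Poly_Mapping.keys m"
    by (auto simp: poly_vars_def)
  moreover from this(1) obtain k l
    where "m = k + l" "k \<in> Poly_Mapping.keys f" "l \<in> Poly_Mapping.keys g"
    using keys_mult[of f g] by blast
  ultimately show "v \<in> poly_vars f \<union> poly_vars g"
    using keys_add[of k l] by (auto simp: poly_vars_def)
qed

lemma joint_fieldI:
  assumes "F = Fract a b" "b \<noteq> 0"
    and "poly_vars a \<subseteq> {v. v div 4 \<in> {1..n}}" "poly_vars b \<subseteq> {v. v div 4 \<in> {1..n}}"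
  shows "F \<in> joint_field n"
  using assms unfolding joint_field_def by blast

lemma joint_fieldE:
  assumes "F \<in> joint_field n"
  obtains a b where "F = Fract a b" "b \<noteq> 0"
    "poly_vars a \<subseteq> {v. v div 4 \<in> {1..n}}" "poly_vars b \<subseteq> {v. v div 4 \<in> {1..n}}"
  using assms unfolding joint_field_def by blast

lemma joint_field_var: "v div 4 \<in> {1..n} \<Longrightarrow> var v \<in> joint_field n"
  by (rule joint_fieldI[OF var_def]) (simp_all add: poly_vars_def)

lemma joint_field_1: "1 \<in> joint_field n"
  by (rule joint_fieldI[OF One_fract_def]) (simp_all add: poly_vars_def)

lemma joint_field_add:
  assumes "F \<in> joint_field n" "G \<in> joint_field n"
  shows "F + G \<in> joint_field n"
proof -
  let ?V = "{v. v div 4 \<in> {1..n}}"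
  obtain a b where 1: "F = Fract a b" "b \<noteq> 0" "poly_vars a \<subseteq> ?V" "poly_vars b \<subseteq> ?V"
    using assms(1) by (rule joint_fieldE)
  obtain c d where 2: "G = Fract c d" "d \<noteq> 0" "poly_vars c \<subseteq> ?V" "poly_vars d \<subseteq> ?V"
    using assms(2) by (rule joint_fieldE)
  show ?thesis
  proof (rule joint_fieldI)
    show "F + G = Fract (a * d + c * b) (b * d)"
      using 1 2 by simp
    show "b * d \<noteq> 0"
      using 1 2 by simp
    show "poly_vars (a * d + c * b) \<subseteq> ?V"
      using poly_vars_add[of "a * d" "c * b"] poly_vars_mult[of a d] poly_vars_mult[of c b] 1(3,4) 2(3,4)
      by blast
    show "poly_vars (b * d) \<subseteq> ?V"
      using poly_vars_mult[of b d] 1(4) 2(4) by blast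
  qed
qed

lemma joint_field_mult:
  assumes "F \<in> joint_field n" "G \<in> joint_field n"
  shows "F * G \<in> joint_field n"
proof -
  let ?V = "{v. v div 4 \<in> {1..n}}"
  obtain a b where 1: "F = Fract a b" "b \<noteq> 0" "poly_vars a \<subseteq> ?V" "poly_vars b \<subseteq> ?V"
    using assms(1) by (rule joint_fieldE)
  obtain c d where 2: "G = Fract c d" "d \<noteq> 0" "poly_vars c \<subseteq> ?V" "poly_vars d \<subseteq> ?V"
    using assms(2) by (rule joint_fieldE)
  show ?thesis
  proof (rule joint_fieldI)
    show "F * G = Fract (a * c) (b * d)"
      using 1 2 by simp
    show "b * d \<noteq> 0"
      using 1 2 by simp
    show "poly_vars (a * c) \<subseteq> ?V"
      using poly_vars_mult[of a c] 1(3) 2(3) by blast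
    show "poly_vars (b * d) \<subseteq> ?V"
      using poly_vars_mult[of b d] 1(4) 2(4) by blast
  qed
qed

lemma joint_field_minus:
  assumes "F \<in> joint_field n"
  shows "- F \<in> joint_field n"
proof -
  obtain a b where "F = Fract a b" "b \<noteq> 0"
      "poly_vars a \<subseteq> {v. v div 4 \<in> {1..n}}" "poly_vars b \<subseteq> {v. v div 4 \<in> {1..n}}"
    using assms by (rule joint_fieldE)
  then show ?thesis
    by (intro joint_fieldI[of _ "- a" b]) simp_all
qed

lemma joint_field_diff: "F \<in> joint_field n \<Longrightarrow> G \<in> joint_field n \<Longrightarrow> F - G \<in> joint_field n"
  using joint_field_add[of F n "- G"] joint_field_minus[of G n] by simp

lemma joint_field_inverse:
  assumes "F \<in> joint_field n"
  shows "inverse F \<in> joint_field n"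
proof (cases "F = 0")
  case True
  with assms show ?thesis by simp
next
  case False
  obtain a b where ab: "F = Fract a b" "b \<noteq> 0"
      "poly_vars a \<subseteq> {v. v div 4 \<in> {1..n}}" "poly_vars b \<subseteq> {v. v div 4 \<in> {1..n}}"
    using assms by (rule joint_fieldE)
  with False have "a \<noteq> 0"
    by (auto simp: fract_collapse)
  with ab show ?thesis
    by (intro joint_fieldI[of _ b a]) simp_all
qed

lemma joint_field_divide: "F \<in> joint_field n \<Longrightarrow> G \<in> joint_field n \<Longrightarrow> F / G \<in> joint_field n"
  by (simp add: divide_inverse joint_field_mult joint_field_inverse)

lemma joint_field_power: "F \<in> joint_field n \<Longrightarrow> F ^ k \<in> joint_field n"
  by (induction k) (simp_all add: joint_field_1 joint_field_mult)

lemma joint_field_prod: "(\<And>i. i \<in> I \<Longrightarrow> F i \<in> joint_field n) \<Longrightarrow> prod F I \<in> joint_field n"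
  by (induction I rule: infinite_finite_induct) (auto simp: joint_field_1 intro: joint_field_mult)

lemmas joint_field_intros = joint_field_add joint_field_mult joint_field_minus joint_field_diff


section \<open>Level lines under a projective transformation\<close>

text \<open>The line through \<open>v\<close> along which the linear form \<open>g\<close> is constant, as a covector in homogeneous
  coordinates: its pairing with \<open>(v\<^sub>1, v\<^sub>2, 1)\<close> is zero.\<close>

definition level_line :: "('a::field)^2 \<Rightarrow> 'a^2 \<Rightarrow> 'a^3" where
  "level_line v g = vector [g$1, g$2, - g$1 * v$1 - g$2 * v$2]"

lemma det_proj_deriv:
  fixes A :: "('a::field)^3^3"
  assumes "homog A v $ 3 \<noteq> 0"
  shows "det (proj_deriv A v) = det A / (homog A v $ 3) ^ 3"
proof -
  define h where "h = homog A v"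
  have v: "h$1 = A$1$1 * v$1 + A$1$2 * v$2 + A$1$3"
     "h$2 = A$2$1 * v$1 + A$2$2 * v$2 + A$2$3"
     "h$3 = A$3$1 * v$1 + A$3$2 * v$2 + A$3$3"
    by (simp_all add: h_def homog_simps)
  have nz: "h$3 \<noteq> 0"
    using assms by (simp add: h_def)
  have "(A$1$1 * h$3 - h$1 * A$3$1) * (A$2$2 * h$3 - h$2 * A$3$2)
      - (A$1$2 * h$3 - h$1 * A$3$2) * (A$2$1 * h$3 - h$2 * A$3$1) = det A * h$3"
    unfolding det_3 v by algebra
  then have "det (proj_deriv A v) = det A * h$3 / ((h$3)^2 * (h$3)^2)"
    by (simp add: proj_deriv_def det_2 Let_def h_def[symmetric] flip: diff_divide_distrib)
  also have "\<dots> = det A / (h$3)^3"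
    using nz by (simp add: field_simps eval_nat_numeral)
  finally show ?thesis
    by (simp add: h_def)
qed

lemma matrix_inv_left_mult:
  fixes M :: "('a::field)^'n^'n"
  assumes "det M \<noteq> 0"
  shows "matrix_inv M ** M = mat 1"
proof -
  have "\<exists>M'. M ** M' = mat 1 \<and> M' ** M = mat 1"
    using assms by (simp flip: invertible_det_nz invertible_def)
  then show ?thesis
    unfolding matrix_inv_def by (rule someI2_ex) blast
qed

text \<open>Write \<open>X = (v, 1)\<close>, let \<open>X'\<close> be the normalised image of \<open>X\<close>, so that \<open>A X = h X'\<close>, and let \<open>\<ell>\<close>, \<open>\<ell>'\<close>
  be the lines before and after. Differentiation gives \<open>A dX = h dX' + dh X'\<close>, and pairing with
  \<open>\<ell>'\<close> kills the second term, since the new line passes through \<open>X'\<close>. The first term is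
  \<open>h\<close> times the pairing of \<open>\<ell>\<close> with \<open>dX\<close>, because that is how gradients are transported. This
  settles two components of \<open>\<ell>' A = h \<ell>\<close>; the third follows as both sides annihilate \<open>X\<close>.\<close>

lemma level_line_covariant:
  fixes A :: "('a::field)^3^3"
  assumes nz: "homog A v $ 3 \<noteq> 0" and det: "det A \<noteq> 0"
  shows "level_line (proj_map A v) (g v* matrix_inv (proj_deriv A v)) v* A
    = homog A v $ 3 *s level_line v g"
proof -
  define h where "h = homog A v"
  define g' where "g' = g v* matrix_inv (proj_deriv A v)"
  have h: "h$1 = A$1$1 * v$1 + A$1$2 * v$2 + A$1$3"
     "h$2 = A$2$1 * v$1 + A$2$2 * v$2 + A$2$3"
     "h$3 = A$3$1 * v$1 + A$3$2 * v$2 + A$3$3"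
    by (simp_all add: h_def homog_simps)
  have nz': "h$3 \<noteq> 0"
    using nz by (simp add: h_def)
  have "det (proj_deriv A v) \<noteq> 0"
    using nz det by (simp add: det_proj_deriv)
  then have "g' v* proj_deriv A v = g"
    by (simp add: g'_def vector_matrix_mul_assoc matrix_inv_left_mult)
  then have g: "g$1 = (g' v* proj_deriv A v)$1" "g$2 = (g' v* proj_deriv A v)$2"
    by simp_all
  have g1: "h$3 * g$1 = g'$1 * A$1$1 + g'$2 * A$2$1
      + (- g'$1 * (h$1 / h$3) - g'$2 * (h$2 / h$3)) * A$3$1"
    unfolding g using nz'
    by (simp add: proj_deriv_def Let_def h_def[symmetric] vector_matrix_mult_def sum_2)
       (simp add: field_simps power2_eq_square)
  have g2: "h$3 * g$2 = g'$1 * A$1$2 + g'$2 * A$2$2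
      + (- g'$1 * (h$1 / h$3) - g'$2 * (h$2 / h$3)) * A$3$2"
    unfolding g using nz'
    by (simp add: proj_deriv_def Let_def h_def[symmetric] vector_matrix_mult_def sum_2)
       (simp add: field_simps power2_eq_square)
  \<comment> \<open>The last component of the new line; \<open>r\<close> below says that the line passes through the new point.\<close>
  define r where "r = - g'$1 * (h$1 / h$3) - g'$2 * (h$2 / h$3)"
  have r: "g'$1 * h$1 + g'$2 * h$2 + r * h$3 = 0"
    using nz' by (simp add: r_def field_simps)
  have g3: "h$3 * (- g$1 * v$1 - g$2 * v$2) = g'$1 * A$1$3 + g'$2 * A$2$3 + r * A$3$3"
  proof -
    have "h$3 * (- g$1 * v$1 - g$2 * v$2) = - (h$3 * g$1) * v$1 - (h$3 * g$2) * v$2"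
      by algebra
    also have "\<dots> = g'$1 * A$1$3 + g'$2 * A$2$3 + r * A$3$3"
      using r unfolding g1 g2 r_def[symmetric] unfolding h by algebra
    finally show ?thesis .
  qed
  show ?thesis
    unfolding g'_def[symmetric] h_def[symmetric] vec_eq_iff forall_3
    using g1 g2 g3 
    by (simp add: level_line_def proj_map_def h_def[symmetric] vector_matrix_mult_def sum_3
        r_def mult.commute)
qed

lemma vector_3_matrix_mult:
  fixes A :: "('a::comm_semiring_1)^3^3"
  shows "(vector [a, b, c] :: 'a^3^3) ** A = vector [a v* A, b v* A, c v* A]"
  by (simp add: vec_eq_iff forall_3 matrix_matrix_mult_def vector_matrix_mult_def sum_3 mult.commute)

lemma det_scale_rows:
  fixes a b c :: "('a::comm_ring_1)^3"
  shows "det (vector [r *s a, s *s b, t *s c] :: 'a^3^3) = r * s * t * det (vector [a, b, c] :: 'a^3^3)"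
  by (simp add: det_3 algebra_simps)


section \<open>The brackets of three level lines\<close>

lemma ell_eq_level_line: "ell i = level_line (pt i) (gradvec i)"
  by (simp add: ell_def level_line_def pt_def gradvec_def)

text \<open>Stated for an arbitrary substitution, as it serves both for the projective action and for the
  numerical specialisation that shows \<open>\<Delta>\<close> to be nonzero.\<close>

lemma substitutes_Delta:
  assumes "\<And>i. L i = level_line (vector [s (4 * i), s (4 * i + 1)]) (vector [s (4 * i + 2), s (4 * i + 3)])"
  shows "substitutes s (Delta i j k) (det (vector [L i, L j, L k] :: jrat^3^3))"
  unfolding Delta_def ell_def det_3 assms level_line_def vector_3 vector_2
    xvar_def yvar_def pvar_def qvar_def
  by (intro substitutes_intros substitutes_var)

lemma coordinate_index_simps:
  "Suc (4 * m) div 4 = m" "Suc (4 * m) mod 4 = 1"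
  "Suc (Suc (4 * m)) div 4 = m" "Suc (Suc (4 * m)) mod 4 = 2"
  by presburger+

lemma Delta_nonzero:
  assumes "i \<noteq> j" "i \<noteq> k" "j \<noteq> k"
  shows "Delta i j k \<noteq> 0"
proof -
  \<comment> \<open>The gradients \<open>(1, 0)\<close> at the origin, \<open>(0, 1)\<close> at the origin and \<open>(1, 0)\<close> at \<open>(1, 0)\<close> have
    the level lines \<open>x = 0\<close>, \<open>y = 0\<close> and \<open>x = 1\<close>, which are not concurrent.\<close>
  define s :: "nat \<Rightarrow> jrat" where "s v = (if v div 4 = i \<and> v mod 4 = 2 \<or> v div 4 = j \<and> v mod 4 = 3
      \<or> v div 4 = k \<and> (v mod 4 = 0 \<or> v mod 4 = 2) then 1 else 0)" for v
  define L :: "nat \<Rightarrow> jrat^3" where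
    "L m = level_line (vector [s (4 * m), s (4 * m + 1)]) (vector [s (4 * m + 2), s (4 * m + 3)])" for m
  have L: "L i = vector [1, 0, 0]" "L j = vector [0, 1, 0]" "L k = vector [1, 0, - 1]"
    using assms by (auto simp: L_def level_line_def s_def coordinate_index_simps)
  have "substitutes s (Delta i j k) (det (vector [L i, L j, L k] :: jrat^3^3))"
    by (rule substitutes_Delta) (rule L_def)
  moreover have "det (vector [L i, L j, L k] :: jrat^3^3) \<noteq> 0"
    by (simp add: L det_3)
  ultimately show ?thesis
    by (rule substitutes_nonzero)
qed

lemma Delta_joint_field:
  assumes "i \<in> {1..n}" "j \<in> {1..n}" "k \<in> {1..n}"
  shows "Delta i j k \<in> joint_field n"
  unfolding Delta_def ell_def det_3 vector_3 xvar_def yvar_def pvar_def qvar_def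
  by (intro joint_field_intros joint_field_var) (use assms in auto)

lemma det_const_mat: "det (const_mat A) = const (det A)"
  by (simp add: det_3 const_mat_def const_add const_diff const_mult)

text \<open>The last row of an invertible matrix is not zero, so the affine function with these coefficients
  is nonzero at one of the points \<open>(0, 0)\<close>, \<open>(1, 0)\<close>, \<open>(0, 1)\<close>.\<close>

lemma generic_denominator_nonzero:
  assumes "det A \<noteq> 0"
  shows "homog (const_mat A) (pt i) $ 3 \<noteq> 0"
proof -
  obtain x y where xy: "A$3$1 * x + A$3$2 * y + A$3$3 \<noteq> 0"
  proof (rule ccontr)
    assume "\<not> thesis"
    then have "A$3$1 * x + A$3$2 * y + A$3$3 = 0" for x y
      using that by blast
    from this[of 0 0] this[of 1 0] this[of 0 1]
    have "A$3$1 = 0" "A$3$2 = 0" "A$3$3 = 0"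
      by simp_all
    then have "det A = 0"
      by (simp add: det_3)
    with assms show False by simp
  qed
  define s where "s v = (if v = 4 * i then const x else const y)" for v :: nat
  have "substitutes s (homog (const_mat A) (pt i) $ 3)
      (const (A$3$1) * s (4 * i) + const (A$3$2) * s (4 * i + 1) + const (A$3$3))"
    unfolding homog_simps pt_def vector_2 xvar_def yvar_def const_mat_def vec_lambda_beta
    by (intro substitutes_intros substitutes_var substitutes_const)
  moreover have "const (A$3$1) * s (4 * i) + const (A$3$2) * s (4 * i + 1) + const (A$3$3)
      = const (A$3$1 * x + A$3$2 * y + A$3$3)"
    by (simp add: s_def const_add const_mult)
  ultimately show ?thesis
    using xy substitutes_nonzero by fastforce
qed

text \<open>Stacking three instances of \<open>level_line_covariant\<close> gives \<open>M' A = diag(h\<^sub>i, h\<^sub>j, h\<^sub>k) M\<close>, where \<open>M\<close>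
  and \<open>M'\<close> are the matrices of the old and the new lines.\<close>

lemma Delta_transform:
  assumes "det A \<noteq> 0"
  defines "h \<equiv> \<lambda>i. homog (const_mat A) (pt i) $ 3"
  shows "substitutes (var_image A) (Delta i j k) (h i * h j * h k / const (det A) * Delta i j k)"
proof -
  define L where "L m = level_line (pt_image A m) (grad_image A m)" for m
  have "vector [x$1, x$2] = x" for x :: "jrat^2"
    by (simp add: vec_eq_iff forall_2)
  then have "L m = level_line (vector [var_image A (4 * m), var_image A (4 * m + 1)])
      (vector [var_image A (4 * m + 2), var_image A (4 * m + 3)])" for m
    by (simp add: L_def var_image_def Let_def coordinate_index_simps)
  then have subst: "substitutes (var_image A) (Delta i j k) (det (vector [L i, L j, L k] :: jrat^3^3))"
    by (rule substitutes_Delta)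
  have "L m v* const_mat A = h m *s ell m" for m
    unfolding L_def pt_image_def grad_image_def ell_eq_level_line h_def
    by (rule level_line_covariant)
      (simp_all add: assms(1) det_const_mat generic_denominator_nonzero)
  then have "(vector [L i, L j, L k] :: jrat^3^3) ** const_mat A
      = vector [h i *s ell i, h j *s ell j, h k *s ell k]"
    by (simp add: vector_3_matrix_mult)
  from arg_cong[OF this, of det]
  have "det (vector [L i, L j, L k] :: jrat^3^3) * const (det A) = h i * h j * h k * Delta i j k"
    by (simp add: det_mul det_const_mat det_scale_rows Delta_def)
  then have "det (vector [L i, L j, L k] :: jrat^3^3) = h i * h j * h k / const (det A) * Delta i j k"
    using assms(1) by (simp add: field_simps)
  with subst show ?thesis by simp
qed


section \<open>Balanced bracket quotients\<close>

text \<open>The common shape of both formulas for \<open>z\<^sub>n\<close>. In the total degree, each index \<open>i \<ge> 5\<close> occurs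
  \<open>e\<close> times, the indices 3 and 4 occur \<open>2 a - b\<close> times, and the indices 1 and 2 occur
  \<open>(n - 4) e + a - 2 b\<close> times.\<close>

definition bracket_quotient :: "nat \<Rightarrow> nat \<Rightarrow> nat \<Rightarrow> nat \<Rightarrow> jrat" where
  "bracket_quotient n e a b = (\<Prod>i=5..n. Delta 1 2 i) ^ e * (Delta 1 3 4 * Delta 2 3 4) ^ a
    / (Delta 1 2 3 * Delta 1 2 4) ^ b"

lemma bracket_quotient_nonzero: "bracket_quotient n e a b \<noteq> 0"
  by (simp add: bracket_quotient_def Delta_nonzero)

lemma bracket_quotient_joint_field: "n \<ge> 5 \<Longrightarrow> bracket_quotient n e a b \<in> joint_field n"
  unfolding bracket_quotient_def
  by (intro joint_field_divide joint_field_mult joint_field_power joint_field_prod Delta_joint_field)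
    auto

text \<open>The exponent count for a balanced quotient, with \<open>u = h\<^sub>1 h\<^sub>2\<close>, \<open>v = h\<^sub>3 h\<^sub>4\<close> and \<open>m = n - 4\<close>. The
  two hypotheses on the exponents say that the indices 3 and 4, and the indices 1 and 2, have total
  degree \<open>e\<close>; they imply that there are \<open>e + a\<close> more brackets in the numerator than in the
  denominator.\<close>

lemma multiplier_identity:
  fixes u v d :: "'a::field"
  assumes "d \<noteq> 0" "u \<noteq> 0" "v \<noteq> 0" and "2 * a = b + e" "m * e + a = e + 2 * b"
  shows "((u / d) ^ m) ^ e * (u * v^2 / d^2) ^ a / (u^2 * v / d^2) ^ b = (u * v) ^ e / d ^ (e + a)"
proof -
  have "((u / d) ^ m) ^ e * (u * v^2 / d^2) ^ a = u ^ (m * e + a) * v ^ (2 * a) / d ^ (m * e + 2 * a)"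
    by (simp add: power_divide power_mult_distrib power_add power_mult)
  also have "m * e + 2 * a = (e + a) + 2 * b"
    using assms(4,5) by linarith
  also have "u ^ (m * e + a) * v ^ (2 * a) / d ^ ((e + a) + 2 * b)
      = (u * v) ^ e / d ^ (e + a) * (u^2 * v / d^2) ^ b"
    unfolding assms(4,5)
    by (simp add: power_divide power_mult_distrib power_add mult_ac flip: power_mult)
  finally show ?thesis
    using assms(1-3) by simp
qed

text \<open>When \<open>n e\<close> is a multiple of 3, the cube roots of the determinant combine to an integral power of it.\<close>

lemma total_jac_cbrt_power:
  assumes "3 * k = n * e"
  shows "total_jac_cbrt n A ^ e
    = const (det A) ^ k / (\<Prod>i=1..n. homog (const_mat A) (pt i) $ 3) ^ e"
proof -
  have "root 3 (det A) ^ (n * e) = (root 3 (det A) ^ 3) ^ k"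
    unfolding assms[symmetric] by (rule power_mult)
  also have "root 3 (det A) ^ 3 = det A"
    by (rule odd_real_root_pow) simp
  finally have "const (root 3 (det A)) ^ (n * e) = const (det A) ^ k"
    by (simp flip: const_power)
  then show ?thesis
    by (simp add: total_jac_cbrt_def prod_dividef power_divide power_mult)
qed

lemma bracket_quotient_transform:
  assumes n: "n \<ge> 5" and det: "det A \<noteq> 0"
    and deg_a: "2 * a = b + e" and deg_n: "(n - 4) * e + a = e + 2 * b"
  shows "substitutes (var_image A) (bracket_quotient n e a b)
    (inverse (total_jac_cbrt n A ^ e) * bracket_quotient n e a b)"
proof -
  define h where "h i = homog (const_mat A) (pt i) $ 3" for i
  define d where "d = const (det A)"
  define H where "H = (\<Prod>i=5..n. h i)"
  define u where "u = h 1 * h 2"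
  define v where "v = h 3 * h 4"
  have h: "h i \<noteq> 0" for i
    unfolding h_def using det by (rule generic_denominator_nonzero)
  have d: "d \<noteq> 0"
    using det by (simp add: d_def)
  have uv: "u \<noteq> 0" "v \<noteq> 0"
    using h by (simp_all add: u_def v_def)
  have D: "substitutes (var_image A) (Delta i j k) (h i * h j * h k / d * Delta i j k)" for i j k
    using Delta_transform[OF det] by (simp add: h_def d_def)
  have "substitutes (var_image A) (bracket_quotient n e a b)
    ((\<Prod>i=5..n. h 1 * h 2 * h i / d * Delta 1 2 i) ^ e
      * (h 1 * h 3 * h 4 / d * Delta 1 3 4 * (h 2 * h 3 * h 4 / d * Delta 2 3 4)) ^ a
      / (h 1 * h 2 * h 3 / d * Delta 1 2 3 * (h 1 * h 2 * h 4 / d * Delta 1 2 4)) ^ b)"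
    (is "substitutes _ _ ?R")
    unfolding bracket_quotient_def
    by (intro substitutes_divide substitutes_mult substitutes_power substitutes_prod D)
      (simp add: h d Delta_nonzero)
  moreover have "?R = inverse (total_jac_cbrt n A ^ e) * bracket_quotient n e a b"
  proof -
    have 1: "(\<Prod>i=5..n. h 1 * h 2 * h i / d * Delta 1 2 i)
        = (u / d) ^ (n - 4) * H * (\<Prod>i=5..n. Delta 1 2 i)"
    proof -
      have "(\<Prod>i=5..n. h 1 * h 2 * h i / d * Delta 1 2 i)
          = (\<Prod>i=5..n. (u / d) * h i * Delta 1 2 i)"
        by (simp add: u_def)
      also have "\<dots> = (u / d) ^ card {5..n} * H * (\<Prod>i=5..n. Delta 1 2 i)"
        by (simp only: prod.distrib prod_constant H_def)
      finally show ?thesis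
        by simp
    qed
    have 2: "h 1 * h 3 * h 4 / d * Delta 1 3 4 * (h 2 * h 3 * h 4 / d * Delta 2 3 4)
        = (u * v^2 / d^2) * (Delta 1 3 4 * Delta 2 3 4)"
      by (simp add: u_def v_def power2_eq_square)
    have 3: "h 1 * h 2 * h 3 / d * Delta 1 2 3 * (h 1 * h 2 * h 4 / d * Delta 1 2 4)
        = (u^2 * v / d^2) * (Delta 1 2 3 * Delta 1 2 4)"
      by (simp add: u_def v_def power2_eq_square)
    have "?R = ((u / d) ^ (n - 4)) ^ e * (u * v^2 / d^2) ^ a / (u^2 * v / d^2) ^ b
        * H ^ e * bracket_quotient n e a b"
      unfolding 1 2 3 bracket_quotient_def power_mult_distrib[of "(u / d) ^ (n - 4) * H"]
        power_mult_distrib[of "(u / d) ^ (n - 4)"] power_mult_distrib[of "u * v^2 / d^2"]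
        power_mult_distrib[of "u^2 * v / d^2"]
      by simp
    also have "\<dots> = (u * v * H) ^ e / d ^ (e + a) * bracket_quotient n e a b"
      unfolding multiplier_identity[OF d uv deg_a deg_n] by (simp add: power_mult_distrib)
    also have "u * v * H = (\<Prod>i=1..n. h i)"
    proof -
      have "{1..n} = {1, 2, 3, 4} \<union> {5..n}"
        using n by auto
      then show ?thesis
        by (simp add: prod.union_disjoint u_def v_def H_def mult_ac)
    qed
    \<comment> \<open>Counting brackets in two ways, by number and by index, gives \<open>3 (e + a) = n e\<close>.\<close>
    also have "(\<Prod>i=1..n. h i) ^ e / d ^ (e + a) = inverse (total_jac_cbrt n A ^ e)"
    proof -
      have "int (n - 4) = int n - 4"
        using n by simp
      then have "(int n - 4) * int e + int a = int e + 2 * int b"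
        using deg_n by (metis of_nat_add of_nat_mult of_nat_numeral)
      then have "int (3 * (e + a)) = int (n * e)"
        using deg_a by (simp add: algebra_simps)
      then have "3 * (e + a) = n * e"
        by (simp only: of_nat_eq_iff)
      then show ?thesis
        by (simp only: total_jac_cbrt_power h_def d_def inverse_divide)
    qed
    finally show ?thesis .
  qed
  ultimately show ?thesis by simp
qed

lemma bracket_quotient_rel_invariant:
  assumes "n \<ge> 5" "2 * a = b + e" "(n - 4) * e + a = e + 2 * b" and w: "3 * w = - of_nat e"
  shows "rel_invariant n w (bracket_quotient n e a b)"
  unfolding rel_invariant_def
proof (intro conjI allI impI)
  show "bracket_quotient n e a b \<in> joint_field n"
    using assms(1) by (rule bracket_quotient_joint_field)
  show "3 * w \<in> \<int>"
    by (simp add: w)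
  fix A :: "real^3^3" assume "invertible A"
  then have "det A \<noteq> 0"
    by (simp add: invertible_det_nz)
  then have "rat_subst (var_image A) (bracket_quotient n e a b)
      = inverse (total_jac_cbrt n A ^ e) * bracket_quotient n e a b"
    using assms(1-3) by (intro rat_subst_eqI bracket_quotient_transform)
  also have "inverse (total_jac_cbrt n A ^ e) = total_jac_pow n A w"
  proof -
    have "\<lfloor>3 * w\<rfloor> = - int e"
      unfolding w by (metis floor_of_int of_int_minus of_int_of_nat_eq)
    then show ?thesis
      by (simp add: total_jac_pow_def power_int_minus)
  qed
  finally show "rat_subst (var_image A) (bracket_quotient n e a b)
      = total_jac_pow n A w * bracket_quotient n e a b" .
qed


section \<open>Uniqueness of the weight\<close>

text \<open>The map \<open>(x, y) \<mapsto> (8 x, y)\<close> is affine, so its total Jacobian is the constant \<open>8\<^sup>n\<close>, whose cube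
  root \<open>2\<^sup>n\<close> is not a root of unity. Comparing the two multipliers of \<open>F\<close> under this map
  determines the weight.\<close>

lemma rel_invariant_weight_unique:
  assumes "n \<ge> 1" "F \<noteq> 0" and w: "rel_invariant n w F" and w': "rel_invariant n w' F"
  shows "w = w'"
proof -
  define A :: "real^3^3" where "A = vector [vector [8, 0, 0], vector [0, 1, 0], vector [0, 0, 1]]"
  have det: "det A = 8"
    by (simp add: A_def det_3)
  then have inv: "invertible A"
    by (simp add: invertible_det_nz)
  have "root 3 8 = (2::real)"
    by (rule real_root_pos_unique) simp_all
  moreover have "homog (const_mat A) (pt i) $ 3 = 1" for i
    by (simp add: homog_simps const_mat_def A_def)
  ultimately have cbrt: "total_jac_cbrt n A = const (2 ^ n)"
    by (simp add: total_jac_cbrt_def det const_power)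
  have "rat_subst (var_image A) F = total_jac_pow n A w * F"
      "rat_subst (var_image A) F = total_jac_pow n A w' * F"
    using w w' inv unfolding rel_invariant_def by blast+
  then have "total_jac_pow n A w = total_jac_pow n A w'"
    using \<open>F \<noteq> 0\<close> by simp
  then have "((2::real) ^ n) powi \<lfloor>3 * w\<rfloor> = (2 ^ n) powi \<lfloor>3 * w'\<rfloor>"
    by (simp add: total_jac_pow_def cbrt flip: const_power_int)
  moreover have "(1::real) < 2 ^ n"
    using \<open>n \<ge> 1\<close> by simp
  ultimately have "\<lfloor>3 * w\<rfloor> = \<lfloor>3 * w'\<rfloor>"
    by (metis linorder_neq_iff power_int_strict_increasing)
  moreover have "3 * w \<in> \<int>" "3 * w' \<in> \<int>"
    using w w' unfolding rel_invariant_def by blast+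
  ultimately have "3 * w = 3 * w'"
    by (metis Ints_cases floor_of_int)
  then show ?thesis by simp
qed

lemma wt_eqI:
  assumes "n \<ge> 1" "F \<noteq> 0" "rel_invariant n w F"
  shows "wt n F = w"
  unfolding wt_def
  by (rule the_equality) (use assms rel_invariant_weight_unique in blast)+

theorem theorem6:
  fixes n :: nat
  assumes "n \<ge> 5"
  shows "rel_invariant n (- 1 / of_nat (gcd n 3)) (zfun n) \<and> wt n (zfun n) = - 1 / of_nat (gcd n 3)"
proof -
  obtain e a b where z: "zfun n = bracket_quotient n e a b"
    and deg: "2 * a = b + e" "(n - 4) * e + a = e + 2 * b" and e: "e * gcd n 3 = 3"
  proof (cases "3 dvd n")
    case True
    then obtain m where m: "n = 3 * m" by blast
    with assms have "m \<ge> 2" by linarith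
    show thesis
    proof (rule that[of 1 "m - 1" "2 * m - 3"])
      show "zfun n = bracket_quotient n 1 (m - 1) (2 * m - 3)"
        by (simp add: zfun_def bracket_quotient_def m)
    qed (use \<open>m \<ge> 2\<close> in \<open>simp_all add: m\<close>)
  next
    case False
    then have "coprime 3 n"
      by (intro prime_imp_coprime) simp_all
    then have g: "gcd n 3 = 1"
      by (subst gcd.commute) (rule coprime_imp_gcd_eq_1)
    show thesis
    proof (rule that[of 3 "n - 3" "2 * n - 9"])
      show "zfun n = bracket_quotient n 3 (n - 3) (2 * n - 9)"
        unfolding zfun_def bracket_quotient_def using g by simp
    qed (use assms g in simp_all)
  qed
  have "3 * (- 1 / of_nat (gcd n 3)) = - (of_nat e :: rat)"
    using arg_cong[OF e, of "of_nat :: nat \<Rightarrow> rat"] by (simp add: field_simps)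
  then have inv: "rel_invariant n (- 1 / of_nat (gcd n 3)) (zfun n)"
    unfolding z using assms deg by (intro bracket_quotient_rel_invariant)
  moreover have "wt n (zfun n) = - 1 / of_nat (gcd n 3)"
    using assms inv by (intro wt_eqI) (simp_all add: z bracket_quotient_nonzero)
  ultimately show ?thesis ..
qed

end
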